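(* Let $x$ be an irrational real number. A finite $\infty$-rational is a strong $\infty$-approximant of $x$ if and only if it is a convergent of the EICF expansion of $x$.
   Context: Rationals are written in reduced form $a/b$ with $a,b$ coprime integers and $b>0$. The $\infty$-rationals are the reduced rationals $a/b$ whose numerator and denominator differ in parity, together with the point $\infty$; a finite $\infty$-rational is one other than $\infty$. A finite $\infty$-rational $a/b$ is a strong $\infty$-approximant of a real number $x$ if for each finite $\infty$-rational $c/d$ such that $d\leq b$ we have $|bx-a|\leq|dx-c|$, with equality if and only if $c/d=a/b$. An even-integer continued fraction (EICF) is a finite, infinite or empty sequence $[b_1,b_2,\dotsc]$ of even integers all of whose terms, except possibly $b_1$, are nonzero. The value of a finite EICF $[b_1,\dots,b_n]$ ($n\geq 1$) is the number $b_1+\cfrac{1}{b_2+\cfrac{1}{b_3+\cdots+\cfrac{1}{b_n}}}$. The convergents of an EICF $[b_1,b_2,\dotsc]$ are the values of $[b_1,\dots,b_n]$ for $n=1,2,\dotsc$. An infinite EICF has value $x$ if its sequence of convergents converges to $x$ in $\mathbb{R}_\infty=\mathbb{R}\cup\{\infty\}$. An EICF expansion of a real number $x$ is an EICF with value $x$; each irrational has a unique EICF expansion, and it is infinite. *)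

theory Defs
  imports "HOL-Analysis.Analysis"
begin

text \<open>
  The library function \<^const>\<open>quotient_of\<close> returns the numerator and denominator of a rational
  in reduced form with positive denominator. The point at infinity is not a \<^typ>\<open>rat\<close>, so a
  predicate on \<^typ>\<open>rat\<close> describes exactly the finite points among the infinity-rationals.
\<close>

definition numer :: "rat \<Rightarrow> int" where
  "numer r = fst (quotient_of r)"

definition denom :: "rat \<Rightarrow> int" where
  "denom r = snd (quotient_of r)"

definition finite_infty_rational :: "rat \<Rightarrow> bool" where
  "finite_infty_rational r \<longleftrightarrow> even (numer r) \<noteq> even (denom r)"

definition strong_infty_approximant :: "real \<Rightarrow> rat \<Rightarrow> bool" where
  "strong_infty_approximant x r \<longleftrightarrow>
     finite_infty_rational r \<and>
     (\<forall>s. finite_infty_rational s \<and> denom s \<le> denom r \<longrightarrow>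
        \<bar>of_int (denom r) * x - of_int (numer r)\<bar> \<le> \<bar>of_int (denom s) * x - of_int (numer s)\<bar> \<and>
        (\<bar>of_int (denom r) * x - of_int (numer r)\<bar> =
           \<bar>of_int (denom s) * x - of_int (numer s)\<bar> \<longleftrightarrow> s = r))"

text \<open>
  A finite, infinite or empty sequence of integers. The term usually written with index 1 is
  the head of the list, respectively the value of the function at 0.
\<close>

datatype int_seq = Fin "int list" | Inf "nat \<Rightarrow> int"

fun eicf :: "int_seq \<Rightarrow> bool" where
  "eicf (Fin bs) \<longleftrightarrow> (\<forall>b \<in> set bs. even b) \<and> (\<forall>b \<in> set (tl bs). b \<noteq> 0)"
| "eicf (Inf b) \<longleftrightarrow> (\<forall>n. even (b n)) \<and> (\<forall>n \<ge> 1. b n \<noteq> 0)"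

text \<open>
  The equation for the empty list is a dummy. No division by zero occurs in the value of an
  EICF: see \<open>abs_cf_value_gt_1\<close> below.
\<close>

fun cf_value :: "int list \<Rightarrow> rat" where
  "cf_value [] = 0"
| "cf_value [b] = of_int b"
| "cf_value (b # c # bs) = of_int b + 1 / cf_value (c # bs)"

lemma abs_cf_value_gt_1:
  assumes "bs \<noteq> []" "\<forall>b \<in> set bs. even b \<and> b \<noteq> 0"
  shows "\<bar>cf_value bs\<bar> > 1"
  using assms
proof (induction bs rule: cf_value.induct)
  case (2 b)
  then have "\<bar>b\<bar> > 1" by auto
  then show ?case by (simp flip: of_int_abs)
next
  case (3 b c bs)
  then have "\<bar>b\<bar> \<ge> 2" by auto
  then have "\<bar>of_int b :: rat\<bar> \<ge> 2" by (simp flip: of_int_abs)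
  moreover have "\<bar>1 / cf_value (c # bs)\<bar> < 1" using 3 by simp
  ultimately show ?case unfolding cf_value.simps by linarith
qed auto

fun convergents :: "int_seq \<Rightarrow> rat set" where
  "convergents (Fin bs) = {cf_value (take n bs) | n. 1 \<le> n \<and> n \<le> length bs}"
| "convergents (Inf b) = {cf_value (map b [0..<n]) | n. 1 \<le> n}"

text \<open>
  Convergence of an infinite EICF takes place in the one-point compactification of the reals,
  where \<^term>\<open>Some x\<close> is the real number \<open>x\<close> and \<^term>\<open>None\<close> is the point at infinity.
  The empty sequence does not have a real value.
\<close>

fun has_value :: "int_seq \<Rightarrow> real \<Rightarrow> bool" where
  "has_value (Fin bs) x \<longleftrightarrow> bs \<noteq> [] \<and> of_rat (cf_value bs) = x"
| "has_value (Inf b) x \<longleftrightarrow>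
     limitin (Alexandroff_compactification euclideanreal)
       (\<lambda>n. Some (of_rat (cf_value (map b [0..<Suc n])))) (Some x) sequentially"

lemma limitin_Alexandroff_Some_iff:
  "limitin (Alexandroff_compactification euclideanreal) (\<lambda>n. Some (f n)) (Some x) F
    \<longleftrightarrow> (f \<longlongrightarrow> x) F" (is "?L \<longleftrightarrow> ?R")
proof
  assume L: ?L
  show ?R
  proof (rule topological_tendstoI)
    fix S assume "open S" "x \<in> S"
    then have "\<forall>\<^sub>F n in F. Some (f n) \<in> Some ` S"
      using limitinD [OF L, of "Some ` S"] by simp
    then show "\<forall>\<^sub>F n in F. f n \<in> S"
      by (rule eventually_mono) auto
  qed
next
  assume ?R
  then have "limitin euclideanreal f x F" by simp
  from continuous_map_limit [OF continuous_map_Some this]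
  show ?L by (simp add: o_def)
qed

definition eicf_expansion :: "int_seq \<Rightarrow> real \<Rightarrow> bool" where
  "eicf_expansion s x \<longleftrightarrow> eicf s \<and> has_value s x"

text \<open>Meaningful for irrational \<open>x\<close>, which has exactly one EICF expansion.\<close>

definition the_eicf_expansion :: "real \<Rightarrow> int_seq" where
  "the_eicf_expansion x = (THE s. eicf_expansion s x)"

end

(* Let p_n/q_n be the convergents of x, and let x_n be the complete quotients, so that |x_n| > 1
   for n >= 1 and (q_n x - p_n) x_{n+1} = -(q_{n-1} x - p_{n-1}). As p_n q_{n-1} - p_{n-1} q_n is
   a unit, each infinity-rational c/d has (c,d) = u (p_n,q_n) + v (p_{n-1},q_{n-1}) with integers
   u, v, and as (p_n,q_n) is alternately (even, odd) and (odd, even), u + v is odd, so |u| and |v|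
   differ. If |u| > |v| > 0 then d > |q_n|. If |v| > |u| then
   |dx - c| = |q_n x - p_n| |u - v x_{n+1}| >= |q_{n-1} x - p_{n-1}|.
   So the infinity-rationals other than p_n/q_n with d <= |q_n| do not beat the previous
   convergent. *)
theory Submission
  imports Defs
begin

section \<open>Numerators and denominators\<close>

text \<open>The index is shifted by one: index \<open>0\<close> stands for the formal convergent
  1/0, and index \<open>Suc n\<close> uses the terms \<open>b 0\<close> to
  \<open>b n\<close>.\<close>

fun cf_num :: "(nat \<Rightarrow> int) \<Rightarrow> nat \<Rightarrow> int" where
  "cf_num b 0 = 1"
| "cf_num b (Suc 0) = b 0"
| "cf_num b (Suc (Suc n)) = b (Suc n) * cf_num b (Suc n) + cf_num b n"

fun cf_den :: "(nat \<Rightarrow> int) \<Rightarrow> nat \<Rightarrow> int" where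
  "cf_den b 0 = 0"
| "cf_den b (Suc 0) = 1"
| "cf_den b (Suc (Suc n)) = b (Suc n) * cf_den b (Suc n) + cf_den b n"

text \<open>The recurrences extend a sequence at its end, while \<open>cf_value\<close> recurses
  from the front. This lemma and the next one connect the two.\<close>

lemma cf_num_Suc_shift:
  "cf_num b (Suc n) = b 0 * cf_num (\<lambda>i. b (Suc i)) n + cf_den (\<lambda>i. b (Suc i)) n"
  by (induction "\<lambda>i. b (Suc i)" n rule: cf_num.induct) (simp_all add: algebra_simps)

lemma cf_den_Suc_shift: "cf_den b (Suc n) = cf_num (\<lambda>i. b (Suc i)) n"
  by (induction "\<lambda>i. b (Suc i)" n rule: cf_num.induct) (simp_all add: algebra_simps)

lemma cf_determinant:
  "cf_num b (Suc n) * cf_den b n - cf_num b n * cf_den b (Suc n) = (- 1) ^ Suc n"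
proof (induction n)
  case (Suc n)
  have "cf_num b (Suc (Suc n)) * cf_den b (Suc n) - cf_num b (Suc n) * cf_den b (Suc (Suc n))
      = - (cf_num b (Suc n) * cf_den b n - cf_num b n * cf_den b (Suc n))"
    by (simp add: algebra_simps)
  then show ?case using Suc by simp
qed simp

lemma coprime_cf: "coprime (cf_num b n) (cf_den b n)"
proof (rule coprimeI)
  fix c assume "c dvd cf_num b n" "c dvd cf_den b n"
  then have "c dvd (- 1) ^ Suc n"
    by (metis cf_determinant dvd_diff dvd_mult dvd_mult2)
  then show "is_unit c"
    by (metis dvd_trans is_unit_power_iff minus_dvd_iff one_dvd)
qed

text \<open>Cramer's rule over the integers: the determinant \<open>e\<close> satisfies
  \<open>e * e = 1\<close>, so multiplying by \<open>e\<close> replaces dividing by it.\<close>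

lemma cf_lincomb:
  obtains u v where "a = u * cf_num b (Suc n) + v * cf_num b n"
    and "d = u * cf_den b (Suc n) + v * cf_den b n"
proof
  define P Q P' Q' e where defs: "P = cf_num b (Suc n)" "Q = cf_den b (Suc n)"
    "P' = cf_num b n" "Q' = cf_den b n" "e = P * Q' - P' * Q"
  have "e = (- 1) ^ Suc n"
    unfolding defs by (rule cf_determinant)
  then have e: "e * e = 1"
    by (simp flip: power_mult_distrib)
  have "e * (a * Q' - d * P') * P + e * (d * P - a * Q) * P' = (e * e) * a"
    and "e * (a * Q' - d * P') * Q + e * (d * P - a * Q) * Q' = (e * e) * d"
    by (simp_all add: defs(5) algebra_simps)
  then show "a = e * (a * Q' - d * P') * cf_num b (Suc n) + e * (d * P - a * Q) * cf_num b n"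
    and "d = e * (a * Q' - d * P') * cf_den b (Suc n) + e * (d * P - a * Q) * cf_den b n"
    unfolding e defs(1-4) by auto
qed

text \<open>Modulo 2 the even factor removes the middle term of the recurrence, so parities repeat
  with period 2.\<close>

lemma even_cf:
  assumes "\<And>n. even (b n)"
  shows "even (cf_num b n) \<longleftrightarrow> odd n" "even (cf_den b n) \<longleftrightarrow> even n"
proof -
  have "(even (cf_num b n) \<longleftrightarrow> odd n) \<and> (even (cf_den b n) \<longleftrightarrow> even n)"
    using assms by (induction b n rule: cf_num.induct) auto
  then show "even (cf_num b n) \<longleftrightarrow> odd n" "even (cf_den b n) \<longleftrightarrow> even n"
    by auto
qed

text \<open>Writing q_n for \<open>cf_den b n\<close>, the recurrence gives |q_{n+2}| \<ge> 2
  |q_{n+1}| - |q_n|, which exceeds |q_{n+1}| by induction.\<close>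

lemma abs_cf_den_less:
  assumes "\<And>n. \<bar>b (Suc n)\<bar> \<ge> 2"
  shows "\<bar>cf_den b n\<bar> < \<bar>cf_den b (Suc n)\<bar>"
proof (induction n)
  case (Suc n)
  have "2 * \<bar>cf_den b (Suc n)\<bar> \<le> \<bar>b (Suc n)\<bar> * \<bar>cf_den b (Suc n)\<bar>"
    by (intro mult_right_mono assms) simp
  also have "\<dots> = \<bar>b (Suc n) * cf_den b (Suc n)\<bar>"
    by (simp add: abs_mult)
  finally show ?case
    using Suc by simp
qed simp

lemma abs_cf_den_ge:
  assumes "\<And>n. \<bar>b (Suc n)\<bar> \<ge> 2"
  shows "int n \<le> \<bar>cf_den b n\<bar>"
proof (induction n)
  case (Suc n)
  then show ?case using abs_cf_den_less[of b n, OF assms] by simp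
qed simp

section \<open>Values of finite continued fractions\<close>

lemma cf_value_shift:
  "cf_value (map b [0..<Suc (Suc n)])
     = of_int (b 0) + 1 / cf_value (map (\<lambda>i. b (Suc i)) [0..<Suc n])"
proof -
  have "map b [0..<Suc (Suc n)] = b 0 # b (Suc 0) # map b [Suc (Suc 0)..<Suc (Suc n)]"
    by (simp add: upt_conv_Cons del: upt_Suc)
  moreover have "map (\<lambda>i. b (Suc i)) [0..<Suc n] = b (Suc 0) # map b [Suc (Suc 0)..<Suc (Suc n)]"
    by (simp add: upt_conv_Cons map_Suc_upt[symmetric] comp_def del: upt_Suc)
  ultimately show ?thesis by simp
qed

lemma cf_value_eq:
  assumes "\<And>n. \<bar>b (Suc n)\<bar> \<ge> 2"
  shows "cf_value (map b [0..<Suc n]) = of_int (cf_num b (Suc n)) / of_int (cf_den b (Suc n))"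
  using assms
proof (induction n arbitrary: b)
  case (Suc n)
  let ?c = "\<lambda>i. b (Suc i)"
  have "cf_value (map ?c [0..<Suc n]) = of_int (cf_num ?c (Suc n)) / of_int (cf_den ?c (Suc n))"
    by (rule Suc.IH) (rule Suc.prems)
  \<comment> \<open>This is \<open>cf_den b (Suc (Suc n))\<close>; it must not vanish, so that the
    value of the tail can be inverted.\<close>
  moreover have "cf_num ?c (Suc n) \<noteq> 0"
    using abs_cf_den_less[of b "Suc n", OF Suc.prems] by (simp add: cf_den_Suc_shift del: cf_den.simps)
  ultimately show ?case
    unfolding cf_value_shift cf_num_Suc_shift[of b "Suc n"] cf_den_Suc_shift[of b "Suc n"]
    by (simp add: field_simps del: cf_num.simps cf_den.simps)
qed simp

section \<open>Rationals in reduced form\<close>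

lemma rat_numer_denom: "r = of_int (numer r) / of_int (denom r)"
  by (metis denom_def numer_def prod.collapse quotient_of_div)

lemma denom_pos: "denom r > 0"
  by (metis denom_def prod.collapse quotient_of_denom_pos)

text \<open>\<open>cf_den\<close> can be negative whereas \<open>quotient_of\<close> returns a
  positive denominator, so the reduced form may differ from (p, q) by a common sign.\<close>

lemma numer_denom_cases:
  assumes "coprime p q" "q \<noteq> 0"
  shows "numer (of_int p / of_int q) = p \<and> denom (of_int p / of_int q) = q
    \<or> numer (of_int p / of_int q) = - p \<and> denom (of_int p / of_int q) = - q"
proof -
  have *: "quotient_of (of_int a / of_int c) = (a, c)" if "coprime a c" "c > 0" for a c :: int
    using that by (simp add: quotient_of_Fract flip: Fract_of_int_quotient)
  show ?thesis
  proof (cases "q > 0")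
    case True
    then show ?thesis using * assms by (simp add: numer_def denom_def)
  next
    case False
    then have "quotient_of (of_int (- p) / of_int (- q)) = (- p, - q)"
      using assms by (intro *) auto
    then show ?thesis by (simp add: numer_def denom_def)
  qed
qed

definition approx_error :: "real \<Rightarrow> rat \<Rightarrow> real" where
  "approx_error x r = \<bar>of_int (denom r) * x - of_int (numer r)\<bar>"

lemma approx_error_fraction:
  assumes "coprime p q" "q \<noteq> 0"
  shows "approx_error x (of_int p / of_int q) = \<bar>of_int q * x - of_int p\<bar>"
  using numer_denom_cases[OF assms] by (auto simp: approx_error_def)

lemma denom_fraction:
  assumes "coprime p q" "q \<noteq> 0"
  shows "denom (of_int p / of_int q) = \<bar>q\<bar>"
  using numer_denom_cases[OF assms] denom_pos[of "of_int p / of_int q"] by auto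

lemma finite_infty_rational_fraction:
  assumes "coprime p q" "q \<noteq> 0"
  shows "finite_infty_rational (of_int p / of_int q) \<longleftrightarrow> even p \<noteq> even q"
  using numer_denom_cases[OF assms] by (auto simp: finite_infty_rational_def)

section \<open>Complete quotients\<close>

text \<open>The Euclidean algorithm with even quotients, run on \<open>x 0\<close>. Irrationality
  keeps it from stopping.\<close>

locale complete_quotients =
  fixes b :: "nat \<Rightarrow> int" and x :: "nat \<Rightarrow> real"
  assumes even_b: "even (b n)"
    and near: "\<bar>x n - of_int (b n)\<bar> < 1"
    and irrational: "x n \<notin> \<rat>"
    and x_Suc: "x (Suc n) = 1 / (x n - of_int (b n))"
begin

lemma x_neq_b: "x n \<noteq> of_int (b n)"
  using irrational[of n] by auto

lemma abs_x_Suc: "\<bar>x (Suc n)\<bar> > 1"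
  using near[of n] x_neq_b[of n] by (simp add: x_Suc)

lemma abs_b_Suc: "\<bar>b (Suc n)\<bar> \<ge> 2"
proof -
  have "b (Suc n) \<noteq> 0"
    using near[of "Suc n"] abs_x_Suc[of n] by auto
  moreover obtain k where "b (Suc n) = 2 * k"
    using even_b[of "Suc n"] by (rule evenE)
  ultimately show ?thesis by simp
qed

section \<open>Errors of the convergents\<close>

definition err :: "nat \<Rightarrow> real" where
  "err n = of_int (cf_den b n) * x 0 - of_int (cf_num b n)"

text \<open>Being signed, \<open>err\<close> obeys the same recurrence as \<open>cf_num\<close> and
  \<open>cf_den\<close>. With the induction hypothesis the next error becomes
  \<open>- err (Suc n) * (x (Suc n) - of_int (b (Suc n)))\<close>, whose last factor is the inverse
  of the next complete quotient.\<close>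

lemma err_Suc_mult: "err (Suc n) * x (Suc n) = - err n"
proof (induction n)
  case 0
  then show ?case using x_neq_b[of 0] by (simp add: err_def x_Suc)
next
  case (Suc n)
  have "err (Suc (Suc n)) = of_int (b (Suc n)) * err (Suc n) + err n"
    by (simp add: err_def algebra_simps)
  also have "\<dots> = - err (Suc n) * (x (Suc n) - of_int (b (Suc n)))"
    using Suc by (simp add: algebra_simps)
  finally show ?case
    using x_neq_b[of "Suc n"] by (simp add: x_Suc[of "Suc n"])
qed

lemma abs_err: "\<bar>err n\<bar> = \<bar>err (Suc n)\<bar> * \<bar>x (Suc n)\<bar>"
  by (simp add: err_Suc_mult flip: abs_mult)

lemma err_neq_0: "err n \<noteq> 0"
proof (induction n)
  case (Suc n)
  then show ?case using err_Suc_mult[of n] by auto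
qed (simp add: err_def)

lemma abs_err_Suc_less: "\<bar>err (Suc n)\<bar> < \<bar>err n\<bar>"
  using abs_x_Suc[of n] err_neq_0[of "Suc n"] by (simp add: abs_err[of n])

lemma abs_err_le_1: "\<bar>err n\<bar> \<le> 1"
proof (induction n)
  case (Suc n)
  then show ?case using abs_err_Suc_less[of n] by simp
qed (simp add: err_def)

section \<open>Convergents as rationals, and their limit\<close>

definition conv :: "nat \<Rightarrow> rat" where
  "conv n = of_int (cf_num b n) / of_int (cf_den b n)"

lemma cf_den_Suc_neq_0: "cf_den b (Suc n) \<noteq> 0"
  using abs_cf_den_less[of b n, OF abs_b_Suc] by auto

lemma denom_conv: "denom (conv (Suc n)) = \<bar>cf_den b (Suc n)\<bar>"
  unfolding conv_def by (rule denom_fraction[OF coprime_cf cf_den_Suc_neq_0])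

lemma approx_error_conv: "approx_error (x 0) (conv (Suc n)) = \<bar>err (Suc n)\<bar>"
  unfolding conv_def err_def by (rule approx_error_fraction[OF coprime_cf cf_den_Suc_neq_0])

lemma finite_infty_rational_conv: "finite_infty_rational (conv (Suc n))"
  unfolding conv_def finite_infty_rational_fraction[OF coprime_cf cf_den_Suc_neq_0]
    even_cf[of b, OF even_b] by simp

lemma cf_value_eq_conv: "cf_value (map b [0..<Suc n]) = conv (Suc n)"
  unfolding conv_def by (rule cf_value_eq[of b, OF abs_b_Suc])

lemma convergents_eq: "convergents (Inf b) = range (\<lambda>n. conv (Suc n))"
proof -
  have "{f n | n. 1 \<le> n} = range (\<lambda>n. f (Suc n))" for f :: "nat \<Rightarrow> rat"
    by (auto simp: Suc_le_eq gr0_conv_Suc)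
  then show ?thesis
    unfolding convergents.simps cf_value_eq_conv[symmetric] .
qed

text \<open>The distance of a convergent from \<open>x 0\<close> is its error divided by its
  denominator; errors are at most 1 and denominators grow at least linearly.\<close>

lemma has_value: "has_value (Inf b) (x 0)"
proof -
  have "\<bar>of_rat (conv (Suc n)) - x 0\<bar> \<le> inverse (real (Suc n))" for n
  proof -
    have "of_int (int (Suc n)) \<le> (of_int \<bar>cf_den b (Suc n)\<bar> :: real)"
      using abs_cf_den_ge[of b "Suc n", OF abs_b_Suc] of_int_le_iff by blast
    then have q: "real (Suc n) \<le> \<bar>of_int (cf_den b (Suc n))\<bar>"
      by simp
    have "of_rat (conv (Suc n)) - x 0 = - (err (Suc n) / of_int (cf_den b (Suc n)))"
      using cf_den_Suc_neq_0[of n] by (simp add: conv_def err_def of_rat_divide field_simps)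
    then have "\<bar>of_rat (conv (Suc n)) - x 0\<bar> = \<bar>err (Suc n)\<bar> / \<bar>of_int (cf_den b (Suc n))\<bar>"
      by simp
    also have "\<dots> \<le> 1 / real (Suc n)"
      using q by (intro frac_le abs_err_le_1) auto
    finally show ?thesis by (simp add: inverse_eq_divide)
  qed
  then have "(\<lambda>n. of_rat (conv (Suc n)) - x 0) \<longlonglongrightarrow> 0"
    by (intro Lim_null_comparison[OF _ LIMSEQ_inverse_real_of_nat] always_eventually) simp
  then have "(\<lambda>n. of_rat (conv (Suc n))) \<longlonglongrightarrow> x 0"
    by (simp add: LIM_zero_iff)
  then show ?thesis
    unfolding has_value.simps limitin_Alexandroff_Some_iff cf_value_eq_conv .
qed

lemma eicf: "eicf (Inf b)"
  unfolding eicf.simps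
proof (intro conjI allI impI)
  fix n :: nat assume "n \<ge> 1"
  then show "b n \<noteq> 0" using abs_b_Suc[of "n - 1"] by auto
qed (rule even_b)

section \<open>Convergents compared with other infinity-rationals\<close>

lemma eq_conv_or_approx_error_ge:
  assumes "finite_infty_rational r" "denom r \<le> \<bar>cf_den b (Suc n)\<bar>"
  shows "r = conv (Suc n) \<or> \<bar>err n\<bar> \<le> approx_error (x 0) r"
proof -
  let ?Q = "cf_den b (Suc n)" and ?Q' = "cf_den b n"
  obtain u v where num: "numer r = u * cf_num b (Suc n) + v * cf_num b n"
    and den: "denom r = u * ?Q + v * ?Q'"
    by (rule cf_lincomb)
  \<comment> \<open>Each pair (\<open>cf_num\<close>, \<open>cf_den\<close>) has an odd sum, so
    \<open>numer r + denom r\<close>, which is odd, has the parity of \<open>u + v\<close>.\<close>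
  have "odd (u + v)"
    using assms(1) unfolding finite_infty_rational_def num den
    by (cases "even n") (auto simp: even_cf[OF even_b] simp del: cf_num.simps cf_den.simps)
  then have "\<bar>u\<bar> \<noteq> \<bar>v\<bar>"
    by (auto simp: abs_eq_iff)
  then consider "v = 0" | "v \<noteq> 0" "\<bar>v\<bar> < \<bar>u\<bar>" | "\<bar>u\<bar> < \<bar>v\<bar>"
    by linarith
  then show ?thesis
  proof cases
    case 1
    then have "u \<noteq> 0"
      using den denom_pos[of r] by auto
    then have "r = conv (Suc n)"
      using 1 num den by (subst rat_numer_denom) (simp add: conv_def)
    then show ?thesis ..
  next
    case 2
    \<comment> \<open>This case is impossible: the chain makes \<open>denom r\<close> exceed
      \<open>\<bar>?Q\<bar>\<close>. It is strict because \<open>v\<close> is nonzero and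
      \<open>\<bar>?Q'\<bar> < \<bar>?Q\<bar>\<close>.\<close>
    have "\<bar>?Q\<bar> \<le> (\<bar>u\<bar> - \<bar>v\<bar>) * \<bar>?Q\<bar>"
      using 2 by (simp add: mult_le_cancel_right1)
    also have "\<dots> < \<bar>u\<bar> * \<bar>?Q\<bar> - \<bar>v\<bar> * \<bar>?Q'\<bar>"
      using 2 abs_cf_den_less[of b n, OF abs_b_Suc] by (simp add: left_diff_distrib)
    also have "\<dots> \<le> \<bar>denom r\<bar>"
      unfolding den abs_mult[symmetric] by linarith
    finally show ?thesis
      using assms(2) denom_pos[of r] by simp
  next
    case 3
    let ?y = "x (Suc n)"
    \<comment> \<open>Integrality gives the gap of 1, whence |u - v y| \<ge> |v| |y| - |u| \<ge> |y|
      + |u| (|y| - 1) \<ge> |y|.\<close>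
    have "of_int \<bar>u\<bar> + 1 \<le> (of_int \<bar>v\<bar> :: real)"
      using 3 by linarith
    then have "(of_int \<bar>u\<bar> + 1) * \<bar>?y\<bar> \<le> of_int \<bar>v\<bar> * \<bar>?y\<bar>"
      by (intro mult_right_mono) auto
    moreover have "of_int \<bar>u\<bar> * 1 \<le> of_int \<bar>u\<bar> * \<bar>?y\<bar>"
      using abs_x_Suc[of n] by (intro mult_left_mono) auto
    moreover have "\<bar>of_int v * ?y\<bar> = of_int \<bar>v\<bar> * \<bar>?y\<bar>"
      by (simp add: abs_mult)
    ultimately have y: "\<bar>?y\<bar> \<le> \<bar>of_int u - of_int v * ?y\<bar>"
      unfolding distrib_right by linarith
    have "of_int (denom r) * x 0 - of_int (numer r) = of_int u * err (Suc n) + of_int v * err n"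
      unfolding num den err_def by (simp add: algebra_simps del: cf_num.simps cf_den.simps)
    also have "\<dots> = err (Suc n) * (of_int u - of_int v * ?y)"
    proof -
      have "err n = - (err (Suc n) * ?y)"
        using err_Suc_mult[of n] by simp
      then show ?thesis
        by (simp add: algebra_simps)
    qed
    finally have "approx_error (x 0) r = \<bar>err (Suc n)\<bar> * \<bar>of_int u - of_int v * ?y\<bar>"
      by (simp add: approx_error_def abs_mult)
    then have "\<bar>err n\<bar> \<le> approx_error (x 0) r"
      using y by (simp add: abs_err[of n] mult_left_mono)
    then show ?thesis ..
  qed
qed

text \<open>Every other competitor has error at least \<open>\<bar>err n\<bar>\<close>, which is
  strictly above \<open>\<bar>err (Suc n)\<bar>\<close>; strictness settles the equality
  clause.\<close>

lemma strong_infty_approximant_conv: "strong_infty_approximant (x 0) (conv (Suc n))"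
  unfolding strong_infty_approximant_def approx_error_def[symmetric]
proof (intro conjI allI impI)
  fix s assume "finite_infty_rational s \<and> denom s \<le> denom (conv (Suc n))"
  then have *: "s = conv (Suc n) \<or> \<bar>err n\<bar> \<le> approx_error (x 0) s"
    by (simp only: denom_conv eq_conv_or_approx_error_ge)
  show "approx_error (x 0) (conv (Suc n)) \<le> approx_error (x 0) s"
    using * abs_err_Suc_less[of n] by (auto simp: approx_error_conv)
  show "approx_error (x 0) (conv (Suc n)) = approx_error (x 0) s \<longleftrightarrow> s = conv (Suc n)"
    using * abs_err_Suc_less[of n] by (auto simp: approx_error_conv)
qed (rule finite_infty_rational_conv)

lemma strong_infty_approximant_imp_conv:
  assumes "strong_infty_approximant (x 0) r"
  shows "r \<in> range (\<lambda>n. conv (Suc n))"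
proof -
  have r: "finite_infty_rational r"
    using assms by (simp add: strong_infty_approximant_def)
  \<comment> \<open>The first denominator beyond \<open>denom r\<close>: this places
    \<open>denom r\<close> between two consecutive convergent denominators. As \<open>cf_den\<close>
    starts with 0 and 1, \<open>m\<close> is at least 2.\<close>
  define m where "m = (LEAST m. denom r < \<bar>cf_den b m\<bar>)"
  have "int (nat (denom r) + 1) \<le> \<bar>cf_den b (nat (denom r) + 1)\<bar>"
    by (rule abs_cf_den_ge[of b, OF abs_b_Suc])
  then have "denom r < \<bar>cf_den b (nat (denom r) + 1)\<bar>"
    by linarith
  then have m: "denom r < \<bar>cf_den b m\<bar>"
    unfolding m_def by (rule LeastI)
  have "m \<noteq> 0" "m \<noteq> Suc 0"
    using m denom_pos[of r] by (auto intro: ccontr)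
  then obtain n where n: "m = Suc (Suc n)"
    by (metis not0_implies_Suc)
  have le: "denom (conv (Suc n)) \<le> denom r"
    using not_less_Least[of "Suc n" "\<lambda>m. denom r < \<bar>cf_den b m\<bar>"] n
    unfolding m_def[symmetric] denom_conv by simp
  have "r = conv (Suc (Suc n)) \<or> \<bar>err (Suc n)\<bar> \<le> approx_error (x 0) r"
    using m n by (intro eq_conv_or_approx_error_ge r) simp
  then show ?thesis
  proof
    \<comment> \<open>By \<open>le\<close>, \<open>conv (Suc n)\<close> competes with
      \<open>r\<close>, and it does at least as well, so the equality clause identifies
      them.\<close>
    assume "\<bar>err (Suc n)\<bar> \<le> approx_error (x 0) r"
    then have "conv (Suc n) = r"
      using assms le finite_infty_rational_conv[of n]
      unfolding strong_infty_approximant_def approx_error_def[symmetric]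
      by (metis approx_error_conv order_antisym)
    then show ?thesis by blast
  qed blast
qed

end

section \<open>Existence and uniqueness of the expansion\<close>

lemma ex_even_near:
  fixes x :: real
  assumes "x \<notin> \<rat>"
  obtains c :: int where "even c" "\<bar>x - of_int c\<bar> < 1"
proof
  \<comment> \<open>Twice the integer nearest to \<open>x / 2\<close> lies within 1 of
    \<open>x\<close>; distance exactly 1 would make \<open>x\<close> an integer.\<close>
  let ?c = "2 * round (x / 2)"
  have "\<bar>x - of_int ?c\<bar> \<le> 1"
    using of_int_round_abs_le[of "x / 2"] by linarith
  moreover have "\<bar>x - of_int ?c\<bar> \<noteq> 1"
  proof
    assume "\<bar>x - of_int ?c\<bar> = 1"
    then have "x = of_int (?c + 1) \<or> x = of_int (?c - 1)"
      by (auto simp: abs_if split: if_splits)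
    then show False using assms Rats_of_int by metis
  qed
  ultimately show "\<bar>x - of_int ?c\<bar> < 1" by simp
qed simp

text \<open>One bound is weak because \<open>eicf_limit_head_tail\<close> obtains it by passing to a
  limit.\<close>

lemma even_int_near_unique:
  fixes x :: real
  assumes "even b" "even c" "\<bar>x - of_int b\<bar> < 1" "\<bar>x - of_int c\<bar> \<le> 1"
  shows "b = c"
proof -
  have "\<bar>of_int (b - c) :: real\<bar> < of_int 2"
    using assms(3,4) by simp
  then have "\<bar>b - c\<bar> < 2"
    by linarith
  with assms(1,2) show ?thesis
    by presburger
qed

lemma irrational_inverse_diff:
  fixes x :: real
  assumes "x \<notin> \<rat>"
  shows "1 / (x - of_int c) \<notin> \<rat>"
proof
  assume "1 / (x - of_int c) \<in> \<rat>"
  then have "1 / (1 / (x - of_int c)) + of_int c \<in> \<rat>"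
    by (blast intro: Rats_add Rats_divide Rats_of_int Rats_1)
  moreover have "1 / (1 / (x - of_int c)) + of_int c = x"
    by simp
  ultimately show False using assms by metis
qed

lemma ex_complete_quotients:
  fixes x :: real
  assumes "x \<notin> \<rat>"
  obtains b y where "complete_quotients b y" "y 0 = x"
proof -
  \<comment> \<open>Unspecified where no such integer exists, namely at odd integers
    \<open>t\<close>; every irrational \<open>t\<close> has one.\<close>
  define c :: "real \<Rightarrow> int" where "c t = (SOME c. even c \<and> \<bar>t - of_int c\<bar> < 1)" for t
  define y where "y = rec_nat x (\<lambda>_ t. 1 / (t - of_int (c t)))"
  have c: "even (c t) \<and> \<bar>t - of_int (c t)\<bar> < 1" if "t \<notin> \<rat>" for t
    unfolding c_def by (rule someI_ex) (metis ex_even_near that)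
  have y: "y n \<notin> \<rat>" for n
    by (induction n) (simp_all add: y_def assms irrational_inverse_diff)
  have "complete_quotients (\<lambda>n. c (y n)) y"
    by unfold_locales (use c y in \<open>auto simp: y_def\<close>)
  moreover have "y 0 = x"
    by (simp add: y_def)
  ultimately show ?thesis by (rule that)
qed

section \<open>Uniqueness of the expansion\<close>

lemma eicf_Inf_shift:
  assumes "eicf (Inf b)"
  shows "eicf (Inf (\<lambda>n. b (Suc n)))"
  using assms by simp

text \<open>Peels off one term: the convergents of the tail exceed 1 in absolute value, so all
  convergents after the first lie within 1 of \<open>b 0\<close>.\<close>

lemma eicf_limit_head_tail:
  fixes x :: real
  assumes "eicf (Inf b)" "x \<notin> \<rat>"
    and lim: "(\<lambda>n. of_rat (cf_value (map b [0..<Suc n]))) \<longlonglongrightarrow> x"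
  shows "\<bar>x - of_int (b 0)\<bar> < 1"
    and "(\<lambda>n. of_rat (cf_value (map (\<lambda>i. b (Suc i)) [0..<Suc n]))) \<longlonglongrightarrow> 1 / (x - of_int (b 0))"
proof -
  let ?t = "\<lambda>n. cf_value (map (\<lambda>i. b (Suc i)) [0..<Suc n])"
  have "\<bar>?t n\<bar> > 1" for n
    using assms(1) by (intro abs_cf_value_gt_1) auto
  then have "of_rat \<bar>?t n\<bar> > (of_rat 1 :: real)" for n
    by (simp only: of_rat_less)
  then have t: "\<bar>of_rat (?t n) :: real\<bar> > 1" for n
    by simp
  have "(\<lambda>n. of_rat (cf_value (map b [0..<Suc (Suc n)])) - of_int (b 0)) \<longlonglongrightarrow> x - of_int (b 0)"
    by (intro tendsto_diff LIMSEQ_Suc[OF lim] tendsto_const)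
  then have inv: "(\<lambda>n. 1 / of_rat (?t n)) \<longlonglongrightarrow> x - of_int (b 0)"
    unfolding cf_value_shift by (simp only: of_rat_add of_rat_divide of_rat_1 of_rat_of_int_eq add_diff_cancel_left')
  have "\<bar>x - of_int (b 0)\<bar> \<le> 1"
  proof (rule tendsto_upperbound[OF tendsto_rabs[OF inv]])
    have le_1: "\<bar>1 / a\<bar> \<le> 1" if "\<bar>a\<bar> > 1" for a :: real
      using that by simp
    show "\<forall>\<^sub>F n in sequentially. \<bar>1 / of_rat (?t n) :: real\<bar> \<le> 1"
      by (intro always_eventually allI le_1 t)
  qed simp
  \<comment> \<open>The limit gives only a weak bound; irrationality supplies an even integer at
    distance below 1, and it must be \<open>b 0\<close>.\<close>
  moreover obtain c :: int where c: "even c" "\<bar>x - of_int c\<bar> < 1"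
    using ex_even_near[OF assms(2)] by blast
  moreover have "even (b 0)"
    using assms(1) by simp
  ultimately have "c = b 0"
    by (intro even_int_near_unique)
  then show "\<bar>x - of_int (b 0)\<bar> < 1"
    using c(2) by simp
  have "x - of_int (b 0) \<noteq> 0"
    using assms(2) by auto
  from tendsto_divide[OF tendsto_const inv this, of 1]
  show "(\<lambda>n. of_rat (?t n)) \<longlonglongrightarrow> 1 / (x - of_int (b 0))"
    by simp
qed

text \<open>The heads agree, as both are even and within 1 of \<open>x\<close>. The tails then share
  the limit \<open>1 / (x - of_int (b 0))\<close>, so the induction generalises over
  \<open>x\<close> and both sequences.\<close>

lemma eicf_limit_unique:
  fixes x :: real
  assumes "x \<notin> \<rat>" "eicf (Inf b)" "eicf (Inf c)"
    and "(\<lambda>n. of_rat (cf_value (map b [0..<Suc n]))) \<longlonglongrightarrow> x"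
    and "(\<lambda>n. of_rat (cf_value (map c [0..<Suc n]))) \<longlonglongrightarrow> x"
  shows "b n = c n"
  using assms
proof (induction n arbitrary: b c x)
  case 0
  then show ?case
    using eicf_limit_head_tail(1)[of b x] eicf_limit_head_tail(1)[of c x]
    by (intro even_int_near_unique[of _ _ x]) (auto simp del: upt_Suc)
next
  case (Suc n)
  have "b 0 = c 0"
    using Suc.prems eicf_limit_head_tail(1)[of b x] eicf_limit_head_tail(1)[of c x]
    by (intro even_int_near_unique[of _ _ x]) (auto simp del: upt_Suc)
  then show ?case
    using eicf_limit_head_tail(2)[OF Suc.prems(2,1,4)] eicf_limit_head_tail(2)[OF Suc.prems(3,1,5)]
    by (intro Suc.IH[OF irrational_inverse_diff[OF Suc.prems(1), of "b 0"]] eicf_Inf_shift Suc.prems)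
      simp_all
qed

lemma the_eicf_expansion_eq:
  assumes "x \<notin> \<rat>" "eicf (Inf b)" "has_value (Inf b) x"
  shows "the_eicf_expansion x = Inf b"
  unfolding the_eicf_expansion_def
proof (rule the_equality)
  show "eicf_expansion (Inf b) x"
    using assms by (simp only: eicf_expansion_def)
next
  fix s assume s: "eicf_expansion s x"
  show "s = Inf b"
  proof (cases s)
    \<comment> \<open>A finite continued fraction has a rational value.\<close>
    case (Fin bs)
    then have "x \<in> \<rat>"
      using s by (auto simp: eicf_expansion_def)
    with assms(1) show ?thesis by contradiction
  next
    case (Inf c)
    have "c n = b n" for n
      using assms s unfolding Inf eicf_expansion_def has_value.simps limitin_Alexandroff_Some_iff
      by (intro eicf_limit_unique[of x]) auto
    then show ?thesis by (simp add: Inf fun_eq_iff)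
  qed
qed

theorem theorem6p1:
  fixes x :: real and r :: rat
  assumes "x \<notin> \<rat>"
    and "finite_infty_rational r"
  shows "strong_infty_approximant x r \<longleftrightarrow> r \<in> convergents (the_eicf_expansion x)"
proof -
  obtain b y where "complete_quotients b y" and y: "y 0 = x"
    using ex_complete_quotients[OF assms(1)] .
  then interpret complete_quotients b y by simp
  have "the_eicf_expansion x = Inf b"
    using assms(1) eicf has_value unfolding y by (rule the_eicf_expansion_eq)
  then show ?thesis
    using strong_infty_approximant_conv strong_infty_approximant_imp_conv
    unfolding y by (auto simp only: convergents_eq)
qed

end
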